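(* Assume that $\mathcal{C}\in\otimes^d\mathbb{R}^n$, $\lambda>0$ and $\mathbf{p}_1,\ldots,\mathbf{p}_d\in\Pi^n_o$, and put $P=(\mathbf{p}_1,\ldots,\mathbf{p}_d)$. Consider the entropic relaxation problem $$\min\Big\{\langle\mathcal{C},\mathcal{U}\rangle-\frac1\lambda H(\mathcal{U}):\ \mathcal{U}\in\mathrm{U}(P)\Big\},$$ and let $\mathcal{U}_\lambda\in\mathrm{U}(P)$ be its (unique) minimizer. Then $\mathcal{U}_\lambda$ is the unique scaling of the tensor $\exp(-\lambda\mathcal{C})=[e^{-\lambda c_{i_1,\ldots,i_d}}]$ that lies in $\mathrm{U}(P)$.
   Context: $[n]=\{1,\ldots,n\}$. $\otimes^d\mathbb{R}^n$ is the space of real tensors $\mathcal{U}=[u_{i_1,\ldots,i_d}]$, $i_1,\ldots,i_d\in[n]$; $\otimes^d\mathbb{R}^n_+$ those with nonnegative entries; $\langle\mathcal{C},\mathcal{U}\rangle=\sum_{i_1,\ldots,i_d}c_{i_1,\ldots,i_d}u_{i_1,\ldots,i_d}$. $\Pi^n_o$ is the set of probability vectors in $\mathbb{R}^n$ with all coordinates positive; $\mathbf{p}_j=(p_{1,j},\ldots,p_{n,j})$. $\mathrm{U}(P)$ is the set of $\mathcal{U}\in\otimes^d\mathbb{R}^n_+$ with $\sum_{i_j\in[n],\,j\ne k}u_{i_1,\ldots,i_d}=p_{i_k,k}$ for all $k\in[d]$, $i_k\in[n]$. The entropy is $H(\mathcal{U})=-\sum_{i_1,\ldots,i_d\in[n]}u_{i_1,\ldots,i_d}\log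 u_{i_1,\ldots,i_d}$ (with $0\log0=0$). The function $\mathcal{U}\mapsto\langle\mathcal{C},\mathcal{U}\rangle-\frac1\lambda H(\mathcal{U})$ is strictly convex on the set of probability tensors, so its minimizer on $\mathrm{U}(P)$ is unique. A tensor $\mathcal{U}$ is a scaling of $\mathcal{V}\in\otimes^d\mathbb{R}^n_+$ if there exist vectors $\mathbf{x}_j=(x_{1,j},\ldots,x_{n,j})\in\mathbb{R}^n$, $j\in[d]$, such that $u_{i_1,\ldots,i_d}=\exp(x_{i_1,1}+\cdots+x_{i_d,d})\,v_{i_1,\ldots,i_d}$ for all $i_1,\ldots,i_d\in[n]$. *)

theory Defs
  imports "HOL-Analysis.Analysis"
begin

text \<open>
  The finite types \<open>'d\<close> and \<open>'n\<close> play the roles of \<open>[d]\<close> and \<open>[n]\<close>. A multi-index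
  \<open>(i\<^sub>1, \<dots>, i\<^sub>d)\<close> is a function \<open>'d \<Rightarrow> 'n\<close>, and the space of real \<open>d\<close>-tensors is the
  Euclidean space of vectors indexed by multi-indices, so that the pairing of two
  tensors is the library inner product (see \<open>tensor_pairing\<close>).
\<close>

type_synonym ('d, 'n) tensor = "real ^ ('d \<Rightarrow> 'n)"

lemma tensor_pairing:
  fixes C U :: "('d::finite, 'n::finite) tensor"
  shows "C \<bullet> U = (\<Sum>i\<in>UNIV. C $ i * U $ i)"
  by (simp add: inner_vec_def)

definition nonneg_tensors :: "('d::finite, 'n::finite) tensor set" where
  "nonneg_tensors = {U. \<forall>i. 0 \<le> U $ i}"

definition pos_prob_vectors :: "(real ^ 'n::finite) set" where
  "pos_prob_vectors = {q. (\<forall>m. 0 < q $ m) \<and> (\<Sum>m\<in>UNIV. q $ m) = 1}"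

text \<open>The entry \<open>p\<^bsub>m,k\<^esub>\<close> of the family of marginals is \<open>p k $ m\<close>: the \<open>m\<close>-th coordinate of the \<open>k\<close>-th vector.\<close>

definition transport_polytope ::
    "('d::finite \<Rightarrow> real ^ 'n::finite) \<Rightarrow> ('d, 'n) tensor set" where
  "transport_polytope p =
     {U \<in> nonneg_tensors. \<forall>k m. (\<Sum>i | i k = m. U $ i) = p k $ m}"

text \<open>The convention \<open>0 log 0 = 0\<close> holds because \<open>ln\<close> is total and multiplied by \<open>0\<close>.\<close>

definition entropy :: "('d::finite, 'n::finite) tensor \<Rightarrow> real" where
  "entropy U = - (\<Sum>i\<in>UNIV. U $ i * ln (U $ i))"

definition entropic_objective ::
    "('d::finite, 'n::finite) tensor \<Rightarrow> real \<Rightarrow> ('d, 'n) tensor \<Rightarrow> real" where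
  "entropic_objective C l U = C \<bullet> U - (1 / l) * entropy U"

definition is_scaling ::
    "('d::finite, 'n::finite) tensor \<Rightarrow> ('d, 'n) tensor \<Rightarrow> bool" where
  "is_scaling U V \<longleftrightarrow> V \<in> nonneg_tensors \<and>
     (\<exists>x :: 'd \<Rightarrow> real ^ 'n. \<forall>i. U $ i = exp (\<Sum>j\<in>UNIV. x j $ i j) * V $ i)"

definition gibbs_tensor ::
    "real \<Rightarrow> ('d::finite, 'n::finite) tensor \<Rightarrow> ('d, 'n) tensor" where
  "gibbs_tensor l C = (\<chi> i. exp (- l * C $ i))"

end

theory Submission
  imports Defs "HOL-Real_Asymp.Real_Asymp"
begin

text \<open>
  Up to the factor \<open>1/\<lambda>\<close>, the objective is the relative entropy of \<open>U\<close> with respect to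
  \<open>W = exp (-\<lambda>C)\<close>. If \<open>V \<in> U(P)\<close> is a scaling of \<open>W\<close>, then \<open>ln V - ln W\<close> is a sum of functions of
  single indices, so its pairing with any \<open>U \<in> U(P)\<close> depends on the marginals only; hence the
  objectives of \<open>U\<close> and \<open>V\<close> differ by the relative entropy of \<open>U\<close> with respect to \<open>V\<close>, and Gibbs'
  inequality makes \<open>V\<close> the only minimizer. It remains to see that some minimizer is a scaling.
  A minimizer exists by compactness. It is positive, because the slope of \<open>u ln u\<close> at \<open>0\<close> is \<open>-\<infinity>\<close>
  and \<open>U(P)\<close> contains the positive tensor \<open>p\<^sub>1 \<otimes> \<dots> \<otimes> p\<^sub>d\<close>. Stationarity then makes
  \<open>ln U - ln W\<close> orthogonal to all tensors with zero marginals, that is, a sum of functions of single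
  indices.
\<close>

section \<open>Relative entropy and Gibbs' inequality\<close>

text \<open>The weight \<open>W\<close> need not have the mass of \<open>U\<close>, so the value may
  be negative. Zero entries of \<open>U\<close> contribute 0.\<close>

definition relative_entropy :: "real ^ 'a::finite \<Rightarrow> real ^ 'a \<Rightarrow> real" where
  "relative_entropy U W = (\<Sum>i\<in>UNIV. U $ i * (ln (U $ i) - ln (W $ i)))"

text \<open>Changing the reference tensor costs a term linear in \<open>U\<close>. Both the
  optimality of scalings and the variational inequality rest on this.\<close>

lemma relative_entropy_change:
  "relative_entropy U W = relative_entropy U V + (\<Sum>i\<in>UNIV. U $ i * (ln (V $ i) - ln (W $ i)))"
  unfolding relative_entropy_def sum.distrib [symmetric]
  by (rule sum.cong) (auto simp: algebra_simps)

lemma entropic_objective_eq_relative_entropy: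
  assumes "l \<noteq> 0"
  shows "entropic_objective C l U = (1 / l) * relative_entropy U (gibbs_tensor l C)"
proof -
  have "relative_entropy U (gibbs_tensor l C) = l * (C \<bullet> U) - entropy U"
    unfolding relative_entropy_def entropy_def tensor_pairing gibbs_tensor_def
    by (simp add: algebra_simps sum.distrib sum_distrib_left)
  with assms show ?thesis
    by (simp add: entropic_objective_def field_simps)
qed

text \<open>Entrywise Gibbs inequality: the tangent bound \<open>ln (a / b) \<le> a / b - 1\<close>,
  multiplied by \<open>b\<close>.\<close>

lemma mult_ln_diff_ge:
  fixes a b :: real
  assumes "0 \<le> b" "0 < a"
  shows "b - a \<le> b * (ln b - ln a)"
proof (cases "b = 0")
  case False
  with assms have "b * (ln a - ln b) \<le> b * ((a - b) / b)"
    by (intro mult_left_mono ln_diff_le) auto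
  also have "\<dots> = a - b" using False by simp
  finally show ?thesis by (simp add: right_diff_distrib)
qed (use assms in auto)

text \<open>The logarithm meets its tangent at 1 only there.\<close>

lemma mult_ln_diff_eq:
  fixes a b :: real
  assumes "0 \<le> b" "0 < a" and eq: "b * (ln b - ln a) = b - a"
  shows "b = a"
proof (cases "b = 0")
  case False
  with assms have "0 < b" by simp
  with eq have "ln b - ln a = (b - a) / b"
    by (metis nonzero_mult_div_cancel_left less_irrefl)
  with assms \<open>0 < b\<close> have "ln (a / b) = a / b - 1"
    by (simp add: ln_div diff_divide_distrib)
  with assms \<open>0 < b\<close> have "a / b = 1"
    by (intro ln_eq_minus_one) auto
  with False show ?thesis by simp
qed (use assms in auto)

lemma relative_entropy_nonneg:
  assumes "\<And>i. 0 \<le> U $ i" "\<And>i. 0 < V $ i" "(\<Sum>i\<in>UNIV. U $ i) = (\<Sum>i\<in>UNIV. V $ i)"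
  shows "0 \<le> relative_entropy U V"
proof -
  have "(\<Sum>i\<in>UNIV. U $ i - V $ i) \<le> relative_entropy U V"
    unfolding relative_entropy_def by (intro sum_mono mult_ln_diff_ge assms)
  with assms(3) show ?thesis by (simp add: sum_subtractf)
qed

lemma relative_entropy_eq_0_imp_eq:
  assumes nonneg: "\<And>i. 0 \<le> U $ i" and pos: "\<And>i. 0 < V $ i"
    and sums: "(\<Sum>i\<in>UNIV. U $ i) = (\<Sum>i\<in>UNIV. V $ i)"
    and zero: "relative_entropy U V = 0"
  shows "U = V"
proof -
  have "(\<Sum>i\<in>UNIV. U $ i * (ln (U $ i) - ln (V $ i)) - (U $ i - V $ i)) = 0"
    using zero sums by (simp add: relative_entropy_def sum_subtractf)
  then have "\<forall>i\<in>UNIV. U $ i * (ln (U $ i) - ln (V $ i)) - (U $ i - V $ i) = 0"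
    by (subst (asm) sum_nonneg_eq_0_iff) (auto simp: mult_ln_diff_ge nonneg pos)
  then have "U $ i = V $ i" for i
    by (intro mult_ln_diff_eq [OF nonneg pos]) simp
  then show ?thesis by (simp add: vec_eq_iff)
qed

section \<open>Continuity up to the boundary\<close>

lemma continuous_on_mult_ln: "continuous_on {0..} (\<lambda>x::real. x * ln x)"
  unfolding continuous_on_eq_continuous_within
proof
  fix x :: real
  assume "x \<in> {0..}"
  then consider "x = 0" | "0 < x" by fastforce
  then show "continuous (at x within {0..}) (\<lambda>x. x * ln x)"
  proof cases
    case 1
    have "((\<lambda>x::real. x * ln x) \<longlongrightarrow> 0) (at_right 0)" by real_asymp
    with 1 show ?thesis by (simp add: continuous_within at_within_Ici_at_right)
  next
    case 2
    then show ?thesis by (auto intro!: continuous_intros)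
  qed
qed

lemma continuous_on_relative_entropy:
  "continuous_on nonneg_tensors (\<lambda>U. relative_entropy U W)"
proof -
  have *: "continuous_on nonneg_tensors (\<lambda>U. U $ i * ln (U $ i))" for i
    by (rule continuous_on_compose2 [OF continuous_on_mult_ln])
       (auto simp: nonneg_tensors_def intro!: continuous_intros)
  show ?thesis
    \<comment> \<open>Multiplied out, since at a zero entry only the product
      \<open>U $ i * ln (U $ i)\<close> is continuous, not the logarithm.\<close>
    unfolding relative_entropy_def right_diff_distrib
    by (intro continuous_intros *)
qed

section \<open>Marginals and the transport polytope\<close>

text \<open>Grouping multi-indices by their \<open>j\<close>-th entry shows that pairing with a sum
  of single-index functions sees only the marginals of \<open>U\<close>.\<close>

lemma sum_mult_separable:
  fixes U :: "('d::finite, 'n::finite) tensor" and x :: "'d \<Rightarrow> real ^ 'n"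
  shows "(\<Sum>i\<in>UNIV. U $ i * (\<Sum>j\<in>UNIV. x j $ i j)) =
    (\<Sum>j\<in>UNIV. \<Sum>m\<in>UNIV. x j $ m * (\<Sum>i | i j = m. U $ i))"
proof -
  have *: "(\<Sum>i\<in>UNIV. U $ i * x j $ i j) = (\<Sum>m\<in>UNIV. x j $ m * (\<Sum>i | i j = m. U $ i))" for j
  proof -
    have "(\<Sum>i\<in>UNIV. U $ i * x j $ i j) = (\<Sum>m\<in>UNIV. \<Sum>i | i j = m. U $ i * x j $ i j)"
      using sum.group [of UNIV UNIV "\<lambda>i. i j" "\<lambda>i. U $ i * x j $ i j"] by simp
    then show ?thesis by (simp add: sum_distrib_left mult.commute)
  qed
  have "(\<Sum>i\<in>UNIV. U $ i * (\<Sum>j\<in>UNIV. x j $ i j)) =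
      (\<Sum>j\<in>UNIV. \<Sum>i\<in>UNIV. U $ i * x j $ i j)"
    unfolding sum_distrib_left by (rule sum.swap)
  then show ?thesis by (simp only: *)
qed

lemma sum_eq_sum_marginal:
  fixes U :: "('d::finite, 'n::finite) tensor"
  shows "(\<Sum>i\<in>UNIV. U $ i) = (\<Sum>m\<in>UNIV. \<Sum>i | i k = m. U $ i)"
  using sum.group [of UNIV UNIV "\<lambda>i. i k" "\<lambda>i. U $ i"] by simp

lemma transport_polytopeD:
  assumes "U \<in> transport_polytope p"
  shows "0 \<le> U $ i" "(\<Sum>i | i k = m. U $ i) = p k $ m"
  using assms by (auto simp: transport_polytope_def nonneg_tensors_def)

text \<open>Gives any two members of the polytope equal mass, as Gibbs' inequality requires.\<close>

lemma sum_transport_polytope: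
  assumes "U \<in> transport_polytope p"
  shows "(\<Sum>i\<in>UNIV. U $ i) = (\<Sum>m\<in>UNIV. p k $ m)"
  using sum_eq_sum_marginal [of U k] by (simp add: transport_polytopeD [OF assms])

lemma compact_transport_polytope: "compact (transport_polytope p)"
proof -
  have "0 \<le> U $ i \<and> U $ i \<le> (\<Sum>m\<in>UNIV. p k $ m)" if "U \<in> transport_polytope p" for U i k
    unfolding sum_transport_polytope [OF that, of k, symmetric]
    using transport_polytopeD(1) [OF that] by (auto intro: member_le_sum)
  \<comment> \<open>Here \<open>undefined\<close> is just some element of the index type; any
    marginal gives the total mass.\<close>
  then have "transport_polytope p \<subseteq> cbox 0 (\<chi> i. \<Sum>m\<in>UNIV. p undefined $ m)"
    by (auto simp: mem_box_cart)
  then have "bounded (transport_polytope p)"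
    using bounded_cbox bounded_subset by blast
  moreover have "closed (transport_polytope p)"
    unfolding transport_polytope_def nonneg_tensors_def mem_Collect_eq
    by (intro closed_Collect_conj closed_Collect_all closed_Collect_le closed_Collect_eq
          continuous_intros)
  ultimately show ?thesis by (simp add: compact_eq_bounded_closed)
qed

lemma product_tensor_in_transport_polytope:
  assumes "\<And>j. p j \<in> pos_prob_vectors"
  shows "(\<chi> i. \<Prod>j\<in>UNIV. p j $ i j) \<in> transport_polytope p"
proof -
  have "(\<Sum>i | i k = m. \<Prod>j\<in>UNIV. p j $ i j) = p k $ m" for k m
  proof -
    \<comment> \<open>As a product set, the slice lets the sum of products factor; every factor with
      \<open>j \<noteq> k\<close> is then 1.\<close>
    have slice: "{i. i k = m} = PiE UNIV (\<lambda>j. if j = k then {m} else UNIV)"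
      by (auto simp: PiE_def Pi_def split: if_splits)
    have "(\<Sum>i | i k = m. \<Prod>j\<in>UNIV. p j $ i j) =
        (\<Prod>j\<in>UNIV. \<Sum>r\<in>(if j = k then {m} else UNIV). p j $ r)"
      unfolding slice by (rule prod_sum_PiE [symmetric]) auto
    also have "\<dots> = (\<Prod>j\<in>UNIV. if j = k then p k $ m else 1)"
      using assms by (intro prod.cong) (auto simp: pos_prob_vectors_def)
    finally show ?thesis by simp
  qed
  moreover have "0 \<le> (\<Prod>j\<in>UNIV. p j $ i j)" for i
    using assms by (intro prod_nonneg) (auto simp: pos_prob_vectors_def less_imp_le)
  ultimately show ?thesis
    by (simp add: transport_polytope_def nonneg_tensors_def)
qed

lemma convex_transport_polytope: "convex (transport_polytope p)"
  unfolding convex_def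
  by (auto simp: transport_polytope_def nonneg_tensors_def sum.distrib
        sum_distrib_left [symmetric] distrib_right [symmetric])

section \<open>Scalings are the only minimizers\<close>

lemma scaling_minimizes_relative_entropy:
  fixes U V W :: "('d::finite, 'n::finite) tensor"
  assumes W: "\<And>i. 0 < W $ i" and scaling: "is_scaling V W"
    and U: "U \<in> transport_polytope p" and V: "V \<in> transport_polytope p"
  shows "relative_entropy V W \<le> relative_entropy U W"
    and "relative_entropy U W \<le> relative_entropy V W \<Longrightarrow> U = V"
proof -
  obtain x :: "'d \<Rightarrow> real ^ 'n" where x: "\<And>i. V $ i = exp (\<Sum>j\<in>UNIV. x j $ i j) * W $ i"
    using scaling by (auto simp: is_scaling_def)
  have pos: "0 < V $ i" for i
    by (simp add: x W)
  have sums: "(\<Sum>i\<in>UNIV. U $ i) = (\<Sum>i\<in>UNIV. V $ i)"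
    using sum_transport_polytope U V by metis
  have ln_x: "ln (V $ i) - ln (W $ i) = (\<Sum>j\<in>UNIV. x j $ i j)" for i
    using W by (simp add: x ln_mult less_imp_neq [symmetric])
  \<comment> \<open>\<open>U\<close> may be replaced by \<open>V\<close>, which has the same
    marginals. The Pythagorean identity \<open>*\<close> follows.\<close>
  have "(\<Sum>i\<in>UNIV. U $ i * (ln (V $ i) - ln (W $ i))) = relative_entropy V W"
    by (simp add: relative_entropy_def ln_x sum_mult_separable transport_polytopeD(2) [OF U]
          transport_polytopeD(2) [OF V])
  then have *: "relative_entropy U W = relative_entropy U V + relative_entropy V W"
    using relative_entropy_change [of U W V] by simp
  have "0 \<le> relative_entropy U V"
    using transport_polytopeD(1) [OF U] pos sums by (rule relative_entropy_nonneg)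
  with * show "relative_entropy V W \<le> relative_entropy U W" by simp
  assume "relative_entropy U W \<le> relative_entropy V W"
  with * \<open>0 \<le> relative_entropy U V\<close> have "relative_entropy U V = 0" by simp
  with transport_polytopeD(1) [OF U] pos sums show "U = V"
    by (rule relative_entropy_eq_0_imp_eq)
qed

section \<open>Minimizers are positive and stationary\<close>

text \<open>Optimality without differentiation: the convexity gap is
  \<open>relative_entropy U V\<close>, and the gradient is taken at the positive point
  \<open>V\<close>, as \<open>U\<close> may have zero entries. The constant 1 in the gradient
  cancels by equal masses.\<close>

lemma relative_entropy_variational_inequality:
  assumes U: "U \<in> transport_polytope p" and V: "V \<in> transport_polytope p"
    and pos: "\<And>i. 0 < V $ i"
    and le: "relative_entropy U W \<le> relative_entropy V W"
  shows "0 \<le> (\<Sum>i\<in>UNIV. (V $ i - U $ i) * (ln (V $ i) - ln (W $ i)))"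
proof -
  have "(\<Sum>i\<in>UNIV. U $ i) = (\<Sum>i\<in>UNIV. V $ i)"
    using sum_transport_polytope U V by metis
  then have "0 \<le> relative_entropy U V"
    using transport_polytopeD(1) [OF U] pos by (intro relative_entropy_nonneg)
  with le relative_entropy_change [of U W V]
  have "(\<Sum>i\<in>UNIV. U $ i * (ln (V $ i) - ln (W $ i))) \<le> relative_entropy V W" by simp
  then show ?thesis
    by (simp add: relative_entropy_def left_diff_distrib sum_subtractf)
qed

lemma relative_entropy_minimizer_pos:
  assumes U: "U \<in> transport_polytope p"
    and min: "\<And>V. V \<in> transport_polytope p \<Longrightarrow> relative_entropy U W \<le> relative_entropy V W"
    and Q: "Q \<in> transport_polytope p" "\<And>i. 0 < Q $ i"
  shows "0 < U $ k"
proof (rule ccontr)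
  assume "\<not> 0 < U $ k"
  with transport_polytopeD(1) [OF U, of k] have k: "U $ k = 0" by simp
  define K where "K = (\<Sum>i\<in>UNIV. (Q $ i - U $ i) * (ln (Q $ i) - ln (W $ i)))"
  have "0 \<le> K"
    unfolding K_def using Q min U by (intro relative_entropy_variational_inequality [of _ p])
  \<comment> \<open>Chosen so that \<open>K + Q $ k * ln t = -1\<close>; \<open>0 \<le> K\<close>
    ensures \<open>t \<le> 1\<close>.\<close>
  define t where "t = exp (- (K + 1) / Q $ k)"
  have t: "0 < t" "t \<le> 1" "Q $ k * ln t = - (K + 1)"
    using \<open>0 \<le> K\<close> Q(2) [of k] by (auto simp: t_def intro: divide_nonpos_pos)
  define V where "V = (1 - t) *\<^sub>R U + t *\<^sub>R Q"
  have V: "V \<in> transport_polytope p"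
    unfolding V_def using t by (intro convexD convex_transport_polytope U Q(1)) auto
  have V_nth: "V $ i = U $ i + t * (Q $ i - U $ i)" for i
    by (simp add: V_def algebra_simps)
  have V_pos: "0 < V $ i" for i
    using t Q(2) [of i] transport_polytopeD(1) [OF U, of i]
    by (simp add: V_def add_nonneg_pos)
  \<comment> \<open>At \<open>k\<close>, \<open>V $ k = t * Q $ k\<close> exactly. Elsewhere
    \<open>V $ i\<close> lies between \<open>U $ i\<close> and \<open>Q $ i\<close>, so
    \<open>ln (V $ i) - ln (Q $ i)\<close> and \<open>Q $ i - U $ i\<close> never have the same
    strict sign.\<close>
  have bound: "(Q $ i - U $ i) * (ln (V $ i) - ln (W $ i))
      \<le> (Q $ i - U $ i) * (ln (Q $ i) - ln (W $ i)) + (if i = k then Q $ k * ln t else 0)" for i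
  proof (cases "i = k")
    case True
    with t Q(2) [of k] k show ?thesis
      by (simp add: V_nth ln_mult algebra_simps)
  next
    case False
    have "(Q $ i - U $ i) * (ln (V $ i) - ln (Q $ i)) \<le> 0"
    proof (cases "U $ i \<le> Q $ i")
      case True
      then have "t * (Q $ i - U $ i) \<le> Q $ i - U $ i"
        using t by (intro mult_left_le_one_le) auto
      then have "ln (V $ i) \<le> ln (Q $ i)"
        using V_pos Q(2) by (simp add: V_nth)
      with True show ?thesis by (intro mult_nonneg_nonpos) auto
    next
      case False
      then have "t * (U $ i - Q $ i) \<le> U $ i - Q $ i"
        using t by (intro mult_left_le_one_le) auto
      then have "Q $ i \<le> V $ i"
        by (simp add: V_nth algebra_simps)
      then have "ln (Q $ i) \<le> ln (V $ i)"
        using V_pos Q(2) by simp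
      with False show ?thesis by (intro mult_nonpos_nonneg) auto
    qed
    with False show ?thesis by (simp add: algebra_simps)
  qed
  have "0 \<le> (\<Sum>i\<in>UNIV. (V $ i - U $ i) * (ln (V $ i) - ln (W $ i)))"
    using V V_pos min U by (intro relative_entropy_variational_inequality [of _ p])
  also have "\<dots> = t * (\<Sum>i\<in>UNIV. (Q $ i - U $ i) * (ln (V $ i) - ln (W $ i)))"
    by (simp add: V_nth sum_distrib_left mult.assoc)
  finally have "0 \<le> (\<Sum>i\<in>UNIV. (Q $ i - U $ i) * (ln (V $ i) - ln (W $ i)))"
    using t by (simp add: zero_le_mult_iff)
  also have "\<dots> \<le> (\<Sum>i\<in>UNIV. (Q $ i - U $ i) * (ln (Q $ i) - ln (W $ i)) +
      (if i = k then Q $ k * ln t else 0))"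
    by (rule sum_mono) (rule bound)
  also have "\<dots> = K + Q $ k * ln t"
    by (simp add: sum.distrib K_def)
  finally show False using t by simp
qed

text \<open>Moving along \<open>t *\<^sub>R T\<close> with small \<open>t < 0\<close> stays in the
  polytope; dividing the variational inequality by \<open>t\<close> and letting it tend to 0 gives
  the sign. One sign suffices for a residual whose pairing is its squared norm.\<close>

lemma relative_entropy_minimizer_orthogonal:
  assumes U: "U \<in> transport_polytope p" and pos: "\<And>i. 0 < U $ i"
    and min: "\<And>V. V \<in> transport_polytope p \<Longrightarrow> relative_entropy U W \<le> relative_entropy V W"
    and T: "\<And>k m. (\<Sum>i | i k = m. T $ i) = 0"
  shows "(\<Sum>i\<in>UNIV. T $ i * (ln (U $ i) - ln (W $ i))) \<le> 0"
proof -
  let ?h = "\<lambda>t. \<Sum>i\<in>UNIV. T $ i * (ln (U $ i + t * T $ i) - ln (W $ i))"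
  have "((\<lambda>t. U $ i + t * T $ i) \<longlongrightarrow> U $ i + 0 * T $ i) (at_left 0)" for i
    by (intro tendsto_intros)
  then have lim: "((\<lambda>t. U $ i + t * T $ i) \<longlongrightarrow> U $ i) (at_left 0)" for i
    by simp
  then have "\<forall>\<^sub>F t in at_left 0. \<forall>i. 0 < U $ i + t * T $ i"
    using pos by (intro eventually_all_finite allI order_tendstoD(1))
  moreover have "\<forall>\<^sub>F t::real in at_left 0. t < 0"
    by (simp add: eventually_at_filter)
  ultimately have "\<forall>\<^sub>F t in at_left 0. ?h t \<le> 0"
  proof eventually_elim
    fix t :: real
    assume t_pos: "\<forall>i. 0 < U $ i + t * T $ i" and "t < 0"
    define V where "V = U + t *\<^sub>R T"
    have "V \<in> transport_polytope p"
      using t_pos T transport_polytopeD(2) [OF U]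
      by (simp add: V_def transport_polytope_def nonneg_tensors_def less_imp_le sum.distrib
            sum_distrib_left [symmetric])
    then have "0 \<le> (\<Sum>i\<in>UNIV. (V $ i - U $ i) * (ln (V $ i) - ln (W $ i)))"
      using t_pos U min by (intro relative_entropy_variational_inequality [of _ p]) (auto simp: V_def)
    also have "\<dots> = t * ?h t"
      by (simp add: V_def sum_distrib_left mult.assoc)
    finally show "?h t \<le> 0"
      using \<open>t < 0\<close> by (simp add: zero_le_mult_iff)
  qed
  moreover have "(?h \<longlongrightarrow> (\<Sum>i\<in>UNIV. T $ i * (ln (U $ i) - ln (W $ i)))) (at_left 0)"
    using pos by (intro tendsto_intros lim) (simp add: less_imp_neq [symmetric])
  ultimately show ?thesis
    by (intro tendsto_upperbound) auto
qed

text \<open>Projects the logarithmic ratio \<open>g\<close> onto the separable tensors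
  \<open>S\<close>; the residual \<open>z\<close> has zero marginals, so
  \<open>z \<bullet> z = z \<bullet> g \<le> 0\<close>.\<close>

lemma relative_entropy_minimizer_is_scaling:
  fixes U W :: "('d::finite, 'n::finite) tensor"
  assumes U: "U \<in> transport_polytope p" and pos: "\<And>i. 0 < U $ i" and W: "\<And>i. 0 < W $ i"
    and min: "\<And>V. V \<in> transport_polytope p \<Longrightarrow> relative_entropy U W \<le> relative_entropy V W"
  shows "is_scaling U W"
proof -
  define sep :: "('d \<Rightarrow> real ^ 'n) \<Rightarrow> ('d, 'n) tensor"
    where "sep x = (\<chi> i. \<Sum>j\<in>UNIV. x j $ i j)" for x
  define S where "S = range sep"
  have "subspace S"
  proof (rule subspaceI)
    have "0 = sep (\<lambda>j. 0)" by (simp add: sep_def vec_eq_iff)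
    then show "0 \<in> S" by (simp add: S_def)
  next
    fix a b assume "a \<in> S" "b \<in> S"
    then obtain x y where "a = sep x" "b = sep y" by (auto simp: S_def)
    then have "a + b = sep (\<lambda>j. x j + y j)" by (simp add: sep_def vec_eq_iff sum.distrib)
    then show "a + b \<in> S" by (simp add: S_def)
  next
    fix c a assume "a \<in> S"
    then obtain x where "a = sep x" by (auto simp: S_def)
    then have "c *\<^sub>R a = sep (\<lambda>j. c *\<^sub>R x j)" by (simp add: sep_def vec_eq_iff sum_distrib_left)
    then show "c *\<^sub>R a \<in> S" by (simp add: S_def)
  qed
  define g where "g = (\<chi> i. ln (U $ i) - ln (W $ i))"
  obtain y z where "y \<in> S" and orth: "\<And>w. w \<in> S \<Longrightarrow> orthogonal z w" and g: "g = y + z"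
    using orthogonal_subspace_decomp_exists [of S g] \<open>subspace S\<close> by (metis span_eq_iff)
  have "(\<Sum>i | i k = m. z $ i) = 0" for k m
  proof -
    \<comment> \<open>The indicator of the slice \<open>i k = m\<close> is itself separable.\<close>
    have "0 = z \<bullet> sep (\<lambda>j. if j = k then axis m 1 else 0)"
      using orth by (simp add: S_def orthogonal_def)
    also have "\<dots> = (\<Sum>i\<in>UNIV. z $ i *
        (\<Sum>j\<in>UNIV. (if j = k then axis m 1 else 0 :: real ^ 'n) $ i j))"
      by (simp add: tensor_pairing sep_def)
    also have "\<dots> = (\<Sum>i\<in>UNIV. if i k = m then z $ i else 0)"
    proof (rule sum.cong)
      fix i :: "'d \<Rightarrow> 'n"
      have "(\<Sum>j\<in>UNIV. (if j = k then axis m 1 else 0 :: real ^ 'n) $ i j) =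
          (\<Sum>j\<in>UNIV. if j = k then axis m 1 $ i k else 0)"
        by (rule sum.cong) auto
      then show "z $ i * (\<Sum>j\<in>UNIV. (if j = k then axis m 1 else 0 :: real ^ 'n) $ i j) =
          (if i k = m then z $ i else 0)"
        by (simp add: axis_def)
    qed simp
    also have "\<dots> = (\<Sum>i | i k = m. z $ i)"
      by (simp add: sum.If_cases)
    finally show ?thesis by simp
  qed
  then have "(\<Sum>i\<in>UNIV. z $ i * (ln (U $ i) - ln (W $ i))) \<le> 0"
    by (intro relative_entropy_minimizer_orthogonal [OF U pos min])
  then have "z \<bullet> g \<le> 0"
    by (simp add: tensor_pairing g_def)
  moreover have "z \<bullet> y = 0"
    using orth \<open>y \<in> S\<close> by (simp add: orthogonal_def)
  ultimately have "z \<bullet> z \<le> 0"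
    by (simp add: g inner_add_right)
  then have "z = 0"
    by (metis inner_gt_zero_iff not_less)
  with g \<open>y \<in> S\<close> obtain x where "g = sep x"
    by (auto simp: S_def)
  then have x: "(\<Sum>j\<in>UNIV. x j $ i j) = ln (U $ i) - ln (W $ i)" for i
    by (simp add: g_def sep_def vec_eq_iff)
  have "U $ i = exp (\<Sum>j\<in>UNIV. x j $ i j) * W $ i" for i
    using pos [of i] W [of i] unfolding x by (simp add: exp_diff)
  moreover have "W \<in> nonneg_tensors"
    using W by (simp add: nonneg_tensors_def less_imp_le)
  ultimately show ?thesis
    unfolding is_scaling_def by blast
qed

section \<open>Existence and conclusion\<close>

lemma ex_scaling_in_transport_polytope:
  fixes W :: "('d::finite, 'n::finite) tensor"
  assumes W: "\<And>i. 0 < W $ i" and p: "\<And>j. p j \<in> pos_prob_vectors"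
  obtains U where "U \<in> transport_polytope p" "is_scaling U W"
proof -
  define Q :: "('d, 'n) tensor" where "Q = (\<chi> i. \<Prod>j\<in>UNIV. p j $ i j)"
  have Q: "Q \<in> transport_polytope p"
    unfolding Q_def using p by (rule product_tensor_in_transport_polytope)
  have Q_pos: "0 < Q $ i" for i
    using p by (auto simp: Q_def pos_prob_vectors_def intro!: prod_pos)
  have "continuous_on (transport_polytope p) (\<lambda>U. relative_entropy U W)"
    by (rule continuous_on_subset [OF continuous_on_relative_entropy])
       (auto simp: transport_polytope_def)
  then obtain U where U: "U \<in> transport_polytope p"
    and min: "\<And>V. V \<in> transport_polytope p \<Longrightarrow> relative_entropy U W \<le> relative_entropy V W"
    using continuous_attains_inf [OF compact_transport_polytope] Q by blast
  have "0 < U $ i" for i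
    using relative_entropy_minimizer_pos [OF U min Q Q_pos] .
  then have "is_scaling U W"
    using relative_entropy_minimizer_is_scaling U W min by blast
  with U that show thesis by blast
qed

theorem theorem2p3:
  fixes C :: "('d::finite, 'n::finite) tensor"
    and l :: real
    and p :: "'d \<Rightarrow> real ^ 'n"
  assumes "l > 0"
    and "\<And>j. p j \<in> pos_prob_vectors"
  shows "(\<exists>!U. is_arg_min (entropic_objective C l) (\<lambda>U. U \<in> transport_polytope p) U) \<and>
    (\<forall>U. is_arg_min (entropic_objective C l) (\<lambda>U. U \<in> transport_polytope p) U \<longrightarrow>
      U \<in> transport_polytope p \<and> is_scaling U (gibbs_tensor l C) \<and>
      (\<forall>V \<in> transport_polytope p. is_scaling V (gibbs_tensor l C) \<longrightarrow> V = U))"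
proof -
  let ?W = "gibbs_tensor l C"
  let ?arg_min = "is_arg_min (entropic_objective C l) (\<lambda>U. U \<in> transport_polytope p)"
  have W: "0 < ?W $ i" for i
    by (simp add: gibbs_tensor_def)
  have arg_min_iff: "?arg_min U \<longleftrightarrow> U \<in> transport_polytope p \<and>
      (\<forall>V. V \<in> transport_polytope p \<longrightarrow> relative_entropy U ?W \<le> relative_entropy V ?W)" for U
    using assms(1)
    by (simp add: is_arg_min_linorder entropic_objective_eq_relative_entropy divide_le_cancel)
  \<comment> \<open>Stated for every scaling \<open>V\<close> in the polytope: one such
    \<open>V\<close> yields the unique minimizer, and any other must coincide with it.\<close>
  have unique: "?arg_min U \<longleftrightarrow> U = V" if "V \<in> transport_polytope p" "is_scaling V ?W" for U V
    unfolding arg_min_iff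
    using scaling_minimizes_relative_entropy [OF W that(2) _ that(1)] that(1) by metis
  obtain V where V: "V \<in> transport_polytope p" "is_scaling V ?W"
    using W assms(2) by (rule ex_scaling_in_transport_polytope)
  show ?thesis
    using V unique unfolding unique [OF V] by blast
qed

end
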